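(* Let $\epsilon,\rho\in(0,1)$ be functions of $n$ such that $\epsilon n/\log n\to+\infty$. There is an $\epsilon$-node-DP algorithm $A$ such that, for all $m<\rho\binom n2$, $$\mathbb E_{G\sim G(n,m)}\Big|A(G)-\frac{m}{\binom n2}\Big|^2=O\Big(\max\Big\{\rho,\frac{\log n}{n}\Big\}\cdot\frac{\log n}{n^3\epsilon^2}\Big).$$
   Context: $\mathcal G_n$ is the set of simple undirected graphs on $[n]$, and $G(n,m)$ is the uniform distribution over graphs in $\mathcal G_n$ with exactly $m$ edges ($m$ a nonnegative integer). Rewiring a vertex means inserting or removing an arbitrary set of edges adjacent to it; $d_v(G_1,G_2)$ is the minimum number of vertices of $G_1$ that need to be rewired to obtain $G_2$. A randomized algorithm $A$ on $\mathcal G_n$ (here real-valued) is $\epsilon$-node-DP if $\mathbb P(A(G_1)\in S)\le e^{\epsilon d_v(G_1,G_2)}\mathbb P(A(G_2)\in S)$ for all $G_1,G_2\in\mathcal G_n$ and all measurable $S$. The algorithm may depend on $n,\rho,\epsilon$ but not on $m$; the expectation is also over the randomness of $A$; the $O(\cdot)$ is as $n\to\infty$, uniformly in $m$. *)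

theory Defs
  imports "HOL-Probability.Probability"
begin

text \<open>A simple undirected graph on the vertex set \<open>{1..n}\<close> is identified with its set of edges,
  each edge being a two-element set of vertices.\<close>

type_synonym graph = "nat set set"

definition graphs :: "nat \<Rightarrow> graph set" where
  "graphs n = Pow {e. e \<subseteq> {1..n} \<and> card e = 2}"

definition uniform_graph :: "nat \<Rightarrow> nat \<Rightarrow> graph pmf" where
  "uniform_graph n m = pmf_of_set {G \<in> graphs n. card G = m}"

text \<open>\<open>H\<close> arises from \<open>G\<close> by rewiring the vertices in \<open>W\<close>: every edge that is inserted or
  removed is adjacent to a vertex of \<open>W\<close>. Rewiring one vertex may insert some edges and remove
  others.\<close>

definition rewiring :: "nat set \<Rightarrow> graph \<Rightarrow> graph \<Rightarrow> bool" where
  "rewiring W G H \<longleftrightarrow> (\<forall>e \<in> (H - G) \<union> (G - H). \<exists>v\<in>W. v \<in> e)"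

text \<open>For graphs on \<open>{1..n}\<close> the minimum is attained, since rewiring all of \<open>{1..n}\<close> turns any
  graph into any other.\<close>

definition node_dist :: "nat \<Rightarrow> graph \<Rightarrow> graph \<Rightarrow> nat" where
  "node_dist n G H = (LEAST k. \<exists>W\<subseteq>{1..n}. card W = k \<and> rewiring W G H)"

text \<open>A real-valued randomized algorithm is given by its output distribution on each input graph,
  a Borel probability measure on the reals.\<close>

definition randomized_algorithm :: "nat \<Rightarrow> (graph \<Rightarrow> real measure) \<Rightarrow> bool" where
  "randomized_algorithm n A \<longleftrightarrow> (\<forall>G\<in>graphs n. prob_space (A G) \<and> sets (A G) = sets borel)"

definition node_DP :: "nat \<Rightarrow> real \<Rightarrow> (graph \<Rightarrow> real measure) \<Rightarrow> bool" where
  "node_DP n \<epsilon> A \<longleftrightarrow>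
     (\<forall>G1\<in>graphs n. \<forall>G2\<in>graphs n. \<forall>S\<in>sets borel.
        measure (A G1) S \<le> exp (\<epsilon> * real (node_dist n G1 G2)) * measure (A G2) S)"

text \<open>The expectation of \<open>|A(G) - m / (n choose 2)|\<^sup>2\<close> over both \<open>G\<close> and the randomness of the
  algorithm. It is a nonnegative integral, so that a bound by a real number includes the
  finiteness of the second moment (the Bochner integral would be 0 otherwise).\<close>

definition mean_square_error :: "nat \<Rightarrow> nat \<Rightarrow> (graph \<Rightarrow> real measure) \<Rightarrow> ennreal" where
  "mean_square_error n m A =
     (\<integral>\<^sup>+ G. (\<integral>\<^sup>+ x. ennreal (\<bar>x - real m / real (n choose 2)\<bar>\<^sup>2) \<partial>(A G))
        \<partial>measure_pmf (uniform_graph n m))"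

end

theory Submission
  imports Defs
begin

text \<open>
  Call a graph regular if, for every vertex set \<open>W\<close>, the number of its edges touching \<open>W\<close> deviates
  by at most \<open>|W| D\<close> from the number predicted by its own edge density. Rewiring \<open>W\<close> changes only
  the edges touching \<open>W\<close>, so on the regular graphs the edge density is Lipschitz for node distances
  up to \<open>n / 4\<close>, with constant \<open>\<delta> = 8 D / (n choose 2)\<close>. The algorithm is the exponential mechanism
  whose score is the McShane extension, from the regular graphs to all graphs, of the distance
  (in units of \<open>\<delta>\<close>) between the output and the edge density. The extended score is automatically
  \<open>1\<close>-Lipschitz in the node distance, hence privacy. On a regular graph it agrees
  with the original score up to the level \<open>n / 4\<close>, so the error is of order \<open>(\<delta> / \<epsilon>)\<^sup>2\<close> plus a tail
  \<open>exp (- \<epsilon> n / 8)\<close>, which is negligible because \<open>\<epsilon> n / ln n\<close> tends to infinity. Finally, a Chernoff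
  bound for the hypergeometric distribution and a union bound over \<open>W\<close> show that with
  \<open>D\<close> of order \<open>sqrt (max (\<rho> n) (ln n) * ln n)\<close> a uniform graph with \<open>m\<close> edges is irregular with
  probability \<open>O(n\<^sup>-\<^sup>4)\<close>, which is below the claimed rate.
\<close>

section \<open>Hypergeometric concentration\<close>

lemma sum_power_card_Pow:
  fixes t :: "'a :: comm_semiring_1"
  assumes "finite A"
  shows "(\<Sum>S\<in>Pow A. t ^ card S) = (1 + t) ^ card A"
  using prod_add[OF assms, of "\<lambda>_. t" "\<lambda>_. 1"] by (simp add: add.commute)

lemma card_supersets_of_size:
  assumes "finite U" "S \<subseteq> U" "card S \<le> m"
  shows "card {G. S \<subseteq> G \<and> G \<subseteq> U \<and> card G = m} = (card U - card S) choose (m - card S)"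
proof -
  have fS: "finite S" using assms finite_subset by blast
  have "bij_betw (\<lambda>G. G - S) {G. S \<subseteq> G \<and> G \<subseteq> U \<and> card G = m}
          {B. B \<subseteq> U - S \<and> card B = m - card S}"
  proof (rule bij_betwI[where g = "\<lambda>B. B \<union> S"])
    show "(\<lambda>G. G - S) \<in> {G. S \<subseteq> G \<and> G \<subseteq> U \<and> card G = m} \<rightarrow> {B. B \<subseteq> U - S \<and> card B = m - card S}"
      using fS by (auto simp: card_Diff_subset)
    show "(\<lambda>B. B \<union> S) \<in> {B. B \<subseteq> U - S \<and> card B = m - card S} \<rightarrow> {G. S \<subseteq> G \<and> G \<subseteq> U \<and> card G = m}"
    proof
      fix B assume "B \<in> {B. B \<subseteq> U - S \<and> card B = m - card S}"
      then have B: "B \<subseteq> U - S" "card B = m - card S" by auto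
      then have "finite B" using assms(1) finite_subset by blast
      then have "card (B \<union> S) = m"
        using B fS assms(3) by (subst card_Un_disjoint) auto
      then show "B \<union> S \<in> {G. S \<subseteq> G \<and> G \<subseteq> U \<and> card G = m}" using B assms(2) by auto
    qed
  qed auto
  then have "card {G. S \<subseteq> G \<and> G \<subseteq> U \<and> card G = m} = card {B. B \<subseteq> U - S \<and> card B = m - card S}"
    by (rule bij_betw_same_card)
  also have "\<dots> = card (U - S) choose (m - card S)" using assms by (simp add: n_subsets)
  finally show ?thesis using fS assms by (simp add: card_Diff_subset)
qed

text \<open>The quotient of the two binomials is the probability that a uniform
  \<open>m\<close>-subset of an \<open>N\<close>-set contains a fixed \<open>j\<close>-set: the
  product of \<open>(m - i) / (N - i)\<close> over \<open>i < j\<close>, each factor being at most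
  \<open>m / N\<close>.\<close>

lemma binomial_diff_le:
  fixes N m j :: nat
  assumes "j \<le> m" "m \<le> N"
  shows "real ((N - j) choose (m - j)) \<le> (real m / real N) ^ j * real (N choose m)"
  using assms
proof (induction j)
  case (Suc j)
  have IH: "real ((N - j) choose (m - j)) \<le> (real m / real N) ^ j * real (N choose m)"
    using Suc by simp
  have pos: "0 < m - j" "0 < N - j" "0 < N" using Suc.prems by auto
  have "(m - j) * ((N - j) choose (m - j)) = (N - j) * ((N - Suc j) choose (m - Suc j))"
    using times_binomial_minus1_eq[OF pos(1), of "N - j"] by simp
  then have "real (m - j) * real ((N - j) choose (m - j)) = real (N - j) * real ((N - Suc j) choose (m - Suc j))"
    by (metis of_nat_mult)
  then have "real ((N - Suc j) choose (m - Suc j)) = real (m - j) / real (N - j) * real ((N - j) choose (m - j))"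
    using pos by (simp add: field_simps)
  also have "\<dots> \<le> real m / real N * real ((N - j) choose (m - j))"
  proof (rule mult_right_mono)
    have "real j * real m \<le> real j * real N" using Suc.prems by (intro mult_left_mono) auto
    then have "real (m - j) * real N \<le> real m * real (N - j)"
      using Suc.prems by (simp add: of_nat_diff algebra_simps)
    then show "real (m - j) / real (N - j) \<le> real m / real N"
      using pos by (simp add: divide_simps)
  qed simp
  also have "\<dots> \<le> real m / real N * ((real m / real N) ^ j * real (N choose m))"
    by (intro mult_left_mono IH) auto
  finally show ?case by simp
qed simp

text \<open>Expanding \<open>s ^ |G \<inter> T|\<close> over the subsets of \<open>G \<inter> T\<close> reduces the moment generating function to
  the probabilities \<open>P(S \<subseteq> G) \<le> (m / N) ^ |S|\<close>.\<close>

lemma hypergeometric_mgf_upper: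
  fixes s :: real
  assumes "finite U" "T \<subseteq> U" "m \<le> card U" "1 \<le> s"
  shows "(\<Sum>G | G \<subseteq> U \<and> card G = m. s ^ card (G \<inter> T))
    \<le> real (card U choose m) * (1 + (s - 1) * (real m / real (card U))) ^ card T"
proof -
  let ?p = "real m / real (card U)"
  let ?F = "{G. G \<subseteq> U \<and> card G = m}"
  have fT: "finite T" using assms finite_subset by blast
  have fF: "finite ?F" using assms(1) by auto
  have "(\<Sum>G\<in>?F. s ^ card (G \<inter> T)) = (\<Sum>G\<in>?F. \<Sum>S\<in>Pow T. if S \<subseteq> G then (s - 1) ^ card S else 0)"
  proof (rule sum.cong[OF refl])
    fix G
    have "s ^ card (G \<inter> T) = (\<Sum>S\<in>Pow (G \<inter> T). (s - 1) ^ card S)"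
      using fT by (subst sum_power_card_Pow) auto
    also have "\<dots> = (\<Sum>S\<in>Pow T. if S \<subseteq> G then (s - 1) ^ card S else 0)"
      using fT by (intro sum.mono_neutral_cong_left) auto
    finally show "s ^ card (G \<inter> T) = \<dots>" .
  qed
  also have "\<dots> = (\<Sum>S\<in>Pow T. \<Sum>G\<in>?F. if S \<subseteq> G then (s - 1) ^ card S else 0)"
    by (rule sum.swap)
  also have "\<dots> \<le> (\<Sum>S\<in>Pow T. real (card U choose m) * ((s - 1) * ?p) ^ card S)"
  proof (rule sum_mono)
    fix S assume S: "S \<in> Pow T"
    then have "S \<subseteq> U" using assms by auto
    have eq: "{G. G \<subseteq> U \<and> card G = m \<and> S \<subseteq> G} = {G. S \<subseteq> G \<and> G \<subseteq> U \<and> card G = m}" by auto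
    have "real (card {G. S \<subseteq> G \<and> G \<subseteq> U \<and> card G = m}) \<le> ?p ^ card S * real (card U choose m)"
    proof (cases "card S \<le> m")
      case True
      then show ?thesis
        using card_supersets_of_size[OF assms(1) \<open>S \<subseteq> U\<close> True] binomial_diff_le[OF True assms(3)] by simp
    next
      case False
      have "{G. S \<subseteq> G \<and> G \<subseteq> U \<and> card G = m} = {}"
      proof -
        have "card S \<le> card G" if "S \<subseteq> G" "G \<subseteq> U" for G
          using that assms(1) by (meson card_mono finite_subset)
        then show ?thesis using False by auto
      qed
      then show ?thesis by (simp only:) simp
    qed
    \<comment> \<open>The weights \<open>(s - 1) ^ card S\<close> are nonnegative because
      \<open>1 \<le> s\<close>, so the bound on each count survives the multiplication.\<close>
    then have "real (card {G. S \<subseteq> G \<and> G \<subseteq> U \<and> card G = m}) * (s - 1) ^ card S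
        \<le> (?p ^ card S * real (card U choose m)) * (s - 1) ^ card S"
      using assms(4) by (intro mult_right_mono) auto
    also have "\<dots> = real (card U choose m) * ((s - 1) * ?p) ^ card S"
      by (simp only: power_mult_distrib mult_ac)
    finally have "real (card {G. S \<subseteq> G \<and> G \<subseteq> U \<and> card G = m}) * (s - 1) ^ card S
        \<le> real (card U choose m) * ((s - 1) * ?p) ^ card S" .
    moreover have "(\<Sum>G\<in>?F. if S \<subseteq> G then (s - 1) ^ card S else 0)
        = real (card {G. S \<subseteq> G \<and> G \<subseteq> U \<and> card G = m}) * (s - 1) ^ card S"
      using fF by (subst sum.inter_filter[symmetric]) (simp_all add: eq conj_assoc)
    ultimately show "(\<Sum>G\<in>?F. if S \<subseteq> G then (s - 1) ^ card S else 0)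
        \<le> real (card U choose m) * ((s - 1) * ?p) ^ card S"
      by linarith
  qed
  also have "\<dots> = real (card U choose m) * (1 + (s - 1) * ?p) ^ card T"
    by (simp only: sum_distrib_left[symmetric] sum_power_card_Pow[OF fT])
  finally show ?thesis .
qed

text \<open>The case \<open>s \<le> 1\<close> is the previous one for the complement of \<open>G\<close> and \<open>1 / s\<close>.\<close>

lemma hypergeometric_mgf_lower:
  fixes s :: real
  assumes "finite U" "T \<subseteq> U" "m \<le> card U" "0 < s" "s \<le> 1"
  shows "(\<Sum>G | G \<subseteq> U \<and> card G = m. s ^ card (G \<inter> T))
    \<le> real (card U choose m) * (1 + (s - 1) * (real m / real (card U))) ^ card T"
proof (cases "card U = 0")
  case True
  then have "U = {}" "T = {}" "m = 0" using assms by auto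
  moreover have "{G :: 'a set. G = {} \<and> card G = 0} = {{}}" by auto
  ultimately show ?thesis by simp
next
  case False
  let ?N = "card U"
  have fT: "finite T" using assms finite_subset by blast
  have cU: "card (U - G) = ?N - card G" if "G \<subseteq> U" for G
    using that assms(1) by (simp add: card_Diff_subset finite_subset)
  have "(\<Sum>G | G \<subseteq> U \<and> card G = m. s ^ card (G \<inter> T))
      = (\<Sum>G | G \<subseteq> U \<and> card G = ?N - m. s ^ card ((U - G) \<inter> T))"
    by (rule sum.reindex_bij_witness[where i = "\<lambda>G. U - G" and j = "\<lambda>G. U - G"])
       (use assms cU in \<open>auto simp: double_diff\<close>)
  also have "\<dots> = (\<Sum>G | G \<subseteq> U \<and> card G = ?N - m. s ^ card T * (1 / s) ^ card (G \<inter> T))"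
  proof (rule sum.cong[OF refl])
    fix G
    have "(U - G) \<inter> T = T - G \<inter> T" using assms by auto
    then have "card ((U - G) \<inter> T) = card T - card (G \<inter> T)"
      using fT by (simp add: card_Diff_subset)
    moreover have "card (G \<inter> T) \<le> card T" using fT by (simp add: card_mono)
    ultimately show "s ^ card ((U - G) \<inter> T) = s ^ card T * (1 / s) ^ card (G \<inter> T)"
      using assms by (simp add: power_diff power_one_over)
  qed
  also have "\<dots> = s ^ card T * (\<Sum>G | G \<subseteq> U \<and> card G = ?N - m. (1 / s) ^ card (G \<inter> T))"
    by (simp add: sum_distrib_left)
  also have "\<dots> \<le> s ^ card T * (real (?N choose (?N - m)) * (1 + (1 / s - 1) * (real (?N - m) / real ?N)) ^ card T)"
    using assms by (intro mult_left_mono hypergeometric_mgf_upper) auto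
  also have "\<dots> = real (?N choose m) * (s * (1 + (1 / s - 1) * (real (?N - m) / real ?N))) ^ card T"
    using assms by (simp add: power_mult_distrib binomial_symmetric[symmetric])
  \<comment> \<open>The complement has density \<open>1 - p\<close> with \<open>p = m / N\<close>,
    and \<open>s + (1 - s) (1 - p) = 1 + (s - 1) p\<close>.\<close>
  also have "s * (1 + (1 / s - 1) * (real (?N - m) / real ?N)) = 1 + (s - 1) * (real m / real ?N)"
    using assms False by (simp add: field_simps of_nat_diff)
  finally show ?thesis .
qed

section \<open>Chernoff bound from the moment generating function\<close>

lemma exp_le_quadratic:
  fixes x :: real
  assumes "\<bar>x\<bar> \<le> 1"
  shows "exp x \<le> 1 + x + x\<^sup>2"
proof (cases "0 \<le> x")
  case True
  then show ?thesis using assms exp_bound by auto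
next
  case False
  define y where "y = - x"
  have y: "0 \<le> y" "y \<le> 1" using False assms by (auto simp: y_def)
  \<comment> \<open>Together with the Taylor lower bound for \<open>exp y\<close>, this polynomial
    inequality gives the bound for \<open>exp (- y)\<close>.\<close>
  have "1 \<le> (1 - y + y\<^sup>2) * (1 + y + y\<^sup>2 / 2)"
  proof -
    have "(1 - y + y\<^sup>2) * (1 + y + y\<^sup>2 / 2) - 1 = y\<^sup>2 * (1 + y + y\<^sup>2) / 2"
      by (simp add: field_simps power2_eq_square)
    also have "\<dots> \<ge> 0" using y by (intro divide_nonneg_pos mult_nonneg_nonneg) auto
    finally show ?thesis by simp
  qed
  also have "\<dots> \<le> (1 - y + y\<^sup>2) * exp y"
    using exp_lower_Taylor_quadratic[OF y(1)] y by (intro mult_left_mono) auto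
  finally have "exp (- y) \<le> 1 - y + y\<^sup>2" by (simp add: exp_minus field_simps)
  then show ?thesis by (simp add: y_def)
qed

text \<open>Centring leaves the exponent \<open>\<mu> (exp l - 1 - l)\<close>, at most
  \<open>\<mu> l^2\<close> for \<open>\<bar>l\<bar> \<le> 1\<close>. Having the mean there instead
  of \<open>card T\<close> is what yields a better rate for sparse graphs.\<close>

lemma hypergeometric_exp_moment:
  fixes l :: real
  assumes "finite U" "T \<subseteq> U" "m \<le> card U" "\<bar>l\<bar> \<le> 1"
  defines "\<mu> \<equiv> real m / real (card U) * real (card T)"
  shows "(\<Sum>G | G \<subseteq> U \<and> card G = m. exp (l * (real (card (G \<inter> T)) - \<mu>)))
    \<le> real (card U choose m) * exp (\<mu> * l\<^sup>2)"
proof -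
  let ?p = "real m / real (card U)"
  have p: "0 \<le> ?p" "?p \<le> 1" using assms by (auto simp: divide_le_eq)
  have "(\<Sum>G | G \<subseteq> U \<and> card G = m. exp (l * (real (card (G \<inter> T)) - \<mu>)))
      = exp (- l * \<mu>) * (\<Sum>G | G \<subseteq> U \<and> card G = m. exp l ^ card (G \<inter> T))"
    by (simp add: sum_distrib_left exp_of_nat_mult[symmetric] mult_exp_exp algebra_simps)
  also have "\<dots> \<le> exp (- l * \<mu>) * (real (card U choose m) * (1 + (exp l - 1) * ?p) ^ card T)"
  proof (intro mult_left_mono)
    show "(\<Sum>G | G \<subseteq> U \<and> card G = m. exp l ^ card (G \<inter> T))
      \<le> real (card U choose m) * (1 + (exp l - 1) * ?p) ^ card T"
      using hypergeometric_mgf_upper[OF assms(1-3), of "exp l"]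
        hypergeometric_mgf_lower[OF assms(1-3), of "exp l"]
      by (cases "0 \<le> l") auto
  qed simp
  also have "\<dots> \<le> exp (- l * \<mu>) * (real (card U choose m) * exp ((exp l - 1) * ?p) ^ card T)"
  proof (intro mult_left_mono power_mono)
    show "1 + (exp l - 1) * ?p \<le> exp ((exp l - 1) * ?p)" by (rule exp_ge_add_one_self)
    have "- 1 \<le> (exp l - 1) * ?p"
    proof -
      have "- 1 \<le> (- 1) * ?p" using p(2) by simp
      also have "\<dots> \<le> (exp l - 1) * ?p" using p(1) by (intro mult_right_mono) auto
      finally show ?thesis .
    qed
    then show "0 \<le> 1 + (exp l - 1) * ?p" by simp
  qed auto
  also have "\<dots> = real (card U choose m) * exp (\<mu> * (exp l - 1 - l))"
    by (simp add: exp_of_nat_mult[symmetric] mult_exp_exp \<mu>_def algebra_simps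
        diff_divide_distrib add_divide_distrib)
  also have "\<dots> \<le> real (card U choose m) * exp (\<mu> * l\<^sup>2)"
  proof -
    have "\<mu> * (exp l - 1 - l) \<le> \<mu> * l\<^sup>2"
      using exp_le_quadratic[OF assms(4)] p by (intro mult_left_mono) (auto simp: \<mu>_def)
    then show ?thesis by (intro mult_left_mono) auto
  qed
  finally show ?thesis .
qed

text \<open>Markov's inequality for the exponential moments at \<open>l\<close> and
  \<open>- l\<close>. The parameter \<open>l\<close> stays free, so that a single choice can serve
  all vertex sets in the union bound.\<close>

lemma hypergeometric_tail:
  fixes l a :: real
  assumes "finite U" "T \<subseteq> U" "m \<le> card U" "0 \<le> l" "l \<le> 1"
  defines "\<mu> \<equiv> real m / real (card U) * real (card T)"
  shows "real (card {G. G \<subseteq> U \<and> card G = m \<and> a < \<bar>real (card (G \<inter> T)) - \<mu>\<bar>})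
    \<le> 2 * real (card U choose m) * exp (\<mu> * l\<^sup>2 - l * a)"
proof -
  let ?F = "{G. G \<subseteq> U \<and> card G = m}"
  let ?d = "\<lambda>G. real (card (G \<inter> T)) - \<mu>"
  have fF: "finite ?F" using assms(1) by auto
  have "real (card {G. G \<subseteq> U \<and> card G = m \<and> a < \<bar>?d G\<bar>}) * exp (l * a)
      = (\<Sum>G | G \<subseteq> U \<and> card G = m \<and> a < \<bar>?d G\<bar>. exp (l * a))" by simp
  also have "\<dots> \<le> (\<Sum>G | G \<subseteq> U \<and> card G = m \<and> a < \<bar>?d G\<bar>. exp (l * ?d G) + exp ((- l) * ?d G))"
  proof (rule sum_mono)
    fix G assume "G \<in> {G. G \<subseteq> U \<and> card G = m \<and> a < \<bar>?d G\<bar>}"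
    then have "l * a \<le> l * \<bar>?d G\<bar>" using assms by (intro mult_left_mono) auto
    then have "exp (l * a) \<le> exp (l * ?d G) \<or> exp (l * a) \<le> exp ((- l) * ?d G)"
      unfolding exp_le_cancel_iff by (cases "0 \<le> ?d G") (auto simp: abs_if algebra_simps)
    then show "exp (l * a) \<le> exp (l * ?d G) + exp ((- l) * ?d G)"
      by (smt (verit) exp_gt_zero)
  qed
  also have "\<dots> \<le> (\<Sum>G\<in>?F. exp (l * ?d G) + exp ((- l) * ?d G))"
    using fF by (intro sum_mono2) (auto intro!: add_nonneg_nonneg)
  also have "\<dots> \<le> 2 * (real (card U choose m) * exp (\<mu> * l\<^sup>2))"
    using hypergeometric_exp_moment[OF assms(1-3), of l] hypergeometric_exp_moment[OF assms(1-3), of "- l"] assms(4,5)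
    by (simp add: sum.distrib \<mu>_def)
  finally show ?thesis by (simp add: exp_diff field_simps)
qed

section \<open>Exponential mechanism with an extended score\<close>

lemma finite_graphs: "finite (graphs n)"
  unfolding graphs_def by (intro iffD2[OF finite_Pow_iff] finite_subset[of _ "Pow {1..n}"]) auto

section \<open>The node distance as a metric\<close>

lemma node_dist_le_card: "W \<subseteq> {1..n} \<Longrightarrow> rewiring W G H \<Longrightarrow> node_dist n G H \<le> card W"
  unfolding node_dist_def by (rule Least_le) blast

lemma node_dist_attained:
  assumes "G \<in> graphs n" "H \<in> graphs n"
  shows "\<exists>W\<subseteq>{1..n}. card W = node_dist n G H \<and> rewiring W G H"
proof -
  have "rewiring {1..n} G H"
    unfolding rewiring_def
  proof
    fix e assume "e \<in> (H - G) \<union> (G - H)"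
    then have "e \<subseteq> {1..n}" "card e = 2" using assms by (auto simp: graphs_def)
    then show "\<exists>v\<in>{1..n}. v \<in> e" by (cases "e = {}") auto
  qed
  then have "\<exists>W\<subseteq>{1..n}. card W = n \<and> rewiring W G H" by (intro exI[of _ "{1..n}"]) auto
  then show ?thesis unfolding node_dist_def by (rule LeastI)
qed

lemma node_dist_refl [simp]: "node_dist n G G = 0"
  using node_dist_le_card[of "{}" n G G] by (simp add: rewiring_def)

lemma node_dist_commute: "node_dist n G H = node_dist n H G"
  unfolding node_dist_def rewiring_def by (simp add: Un_commute)

lemma node_dist_triangle:
  assumes "G \<in> graphs n" "H \<in> graphs n" "K \<in> graphs n"
  shows "node_dist n G K \<le> node_dist n G H + node_dist n H K"
proof -
  obtain V W where V: "V \<subseteq> {1..n}" "card V = node_dist n G H" "rewiring V G H"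
    and W: "W \<subseteq> {1..n}" "card W = node_dist n H K" "rewiring W H K"
    using node_dist_attained assms by metis
  have "rewiring (V \<union> W) G K" using V(3) W(3) unfolding rewiring_def by blast
  then have "node_dist n G K \<le> card (V \<union> W)" using V W by (intro node_dist_le_card) auto
  also have "\<dots> \<le> card V + card W" by (rule card_Un_le)
  finally show ?thesis using V W by simp
qed

text \<open>The infimal convolution of the score with the node distance, separately for each output.
  The minimum runs over all graphs; a smaller set of centres is expressed by giving the others a
  large score.\<close>

definition extended_score :: "nat \<Rightarrow> (graph \<Rightarrow> 'a \<Rightarrow> real) \<Rightarrow> graph \<Rightarrow> 'a \<Rightarrow> real" where
  "extended_score n s G x = (MIN H\<in>graphs n. real (node_dist n G H) + s H x)"

lemma extended_score_le:
  "H \<in> graphs n \<Longrightarrow> extended_score n s G x \<le> real (node_dist n G H) + s H x"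
  unfolding extended_score_def by (intro Min_le) (auto simp: finite_graphs)

lemma extended_score_attained:
  obtains H where "H \<in> graphs n" "extended_score n s G x = real (node_dist n G H) + s H x"
proof -
  have "graphs n \<noteq> {}" by (auto simp: graphs_def)
  then have "extended_score n s G x \<in> (\<lambda>H. real (node_dist n G H) + s H x) ` graphs n"
    unfolding extended_score_def by (intro Min_in) (auto simp: finite_graphs)
  then show ?thesis using that by auto
qed

text \<open>A minimiser for one graph is a candidate for the other, at an extra cost bounded by the
  triangle inequality. The score \<open>s\<close> is arbitrary, so privacy covers irregular graphs
  as well.\<close>

lemma extended_score_lipschitz:
  assumes "G1 \<in> graphs n" "G2 \<in> graphs n"
  shows "\<bar>extended_score n s G1 x - extended_score n s G2 x\<bar> \<le> real (node_dist n G1 G2)"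
proof -
  have *: "extended_score n s G x \<le> real (node_dist n G G') + extended_score n s G' x"
    if "G \<in> graphs n" "G' \<in> graphs n" for G G'
  proof -
    obtain H where H: "H \<in> graphs n" "extended_score n s G' x = real (node_dist n G' H) + s H x"
      by (rule extended_score_attained)
    have "extended_score n s G x \<le> real (node_dist n G H) + s H x"
      using H(1) by (rule extended_score_le)
    then show ?thesis using node_dist_triangle[OF that H(1)] H(2) by linarith
  qed
  show ?thesis using *[OF assms] *[OF assms(2,1)] by (simp add: node_dist_commute[of n G2])
qed

text \<open>Scores are penalties: a small \<open>q j\<close> makes \<open>j\<close> likely. The
  factor \<open>1 / 2\<close> reserves half of the privacy budget for the weights and half for the
  normalising constant.\<close>

definition exponential_mechanism :: "real \<Rightarrow> 'a set \<Rightarrow> ('a \<Rightarrow> real) \<Rightarrow> 'a pmf" where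
  "exponential_mechanism \<epsilon> J q = embed_pmf (\<lambda>j.
     if j \<in> J then exp (- (\<epsilon> / 2) * q j) / (\<Sum>i\<in>J. exp (- (\<epsilon> / 2) * q i)) else 0)"

context
  fixes J :: "'a set"
  assumes J: "finite J" "J \<noteq> {}"
begin

lemma sum_exp_pos: "0 < (\<Sum>i\<in>J. exp (f i :: real))"
  using J by (intro sum_pos) auto

lemma pmf_exponential_mechanism:
  "pmf (exponential_mechanism \<epsilon> J q) j =
     (if j \<in> J then exp (- (\<epsilon> / 2) * q j) / (\<Sum>i\<in>J. exp (- (\<epsilon> / 2) * q i)) else 0)"
  unfolding exponential_mechanism_def
proof (rule pmf_embed_pmf)
  let ?Z = "\<Sum>i\<in>J. exp (- (\<epsilon> / 2) * q i)"
  let ?f = "\<lambda>j. if j \<in> J then exp (- (\<epsilon> / 2) * q j) / ?Z else 0"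
  have Z: "0 < ?Z" by (rule sum_exp_pos)
  show "0 \<le> ?f j" for j using Z by auto
  have "(\<integral>\<^sup>+ x. ennreal (?f x) \<partial>count_space UNIV) = (\<Sum>j\<in>J. ennreal (?f j))"
    using J by (intro nn_integral_count_space') auto
  also have "\<dots> = ennreal (\<Sum>j\<in>J. ?f j)" using Z by (intro sum_ennreal) auto
  also have "(\<Sum>j\<in>J. ?f j) = 1" using Z by (simp add: sum_divide_distrib[symmetric])
  finally show "(\<integral>\<^sup>+ x. ennreal (?f x) \<partial>count_space UNIV) = 1" by simp
qed

lemma set_pmf_exponential_mechanism: "set_pmf (exponential_mechanism \<epsilon> J q) = J"
  using sum_exp_pos[of "\<lambda>i. - (\<epsilon> / 2) * q i"] by (auto simp: set_pmf_eq pmf_exponential_mechanism)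

text \<open>Each weight and the normalising constant change by a factor of at most
  \<open>exp (\<epsilon> / 2 * d)\<close>. As \<open>d\<close> is arbitrary, distant graphs are
  compared directly instead of through a chain of neighbours.\<close>

lemma exponential_mechanism_private:
  assumes d: "\<And>j. j \<in> J \<Longrightarrow> \<bar>q1 j - q2 j\<bar> \<le> d" and "0 \<le> \<epsilon>"
  shows "measure_pmf.prob (exponential_mechanism \<epsilon> J q1) S
    \<le> exp (\<epsilon> * d) * measure_pmf.prob (exponential_mechanism \<epsilon> J q2) S"
proof -
  have exp_le: "exp (- (\<epsilon> / 2) * a) \<le> exp (\<epsilon> / 2 * d) * exp (- (\<epsilon> / 2) * b)"
    if "\<bar>a - b\<bar> \<le> d" for a b :: real
  proof -
    have "\<epsilon> / 2 * (b - a) \<le> \<epsilon> / 2 * d" using that \<open>0 \<le> \<epsilon>\<close> by (intro mult_left_mono) auto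
    then show ?thesis by (simp add: mult_exp_exp algebra_simps)
  qed
  let ?Z = "\<lambda>q. \<Sum>i\<in>J. exp (- (\<epsilon> / 2) * q i)"
  have "?Z q2 \<le> exp (\<epsilon> / 2 * d) * ?Z q1"
    unfolding sum_distrib_left using d by (intro sum_mono exp_le) (simp add: abs_minus_commute)
  then have Z: "1 / ?Z q1 \<le> exp (\<epsilon> / 2 * d) / ?Z q2"
    using sum_exp_pos by (simp add: divide_simps mult.commute)
  have pmf_le: "pmf (exponential_mechanism \<epsilon> J q1) j \<le> exp (\<epsilon> * d) * pmf (exponential_mechanism \<epsilon> J q2) j"
    if "j \<in> J" for j
  proof -
    have "exp (- (\<epsilon> / 2) * q1 j) * (1 / ?Z q1)
        \<le> (exp (\<epsilon> / 2 * d) * exp (- (\<epsilon> / 2) * q2 j)) * (exp (\<epsilon> / 2 * d) / ?Z q2)"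
      using exp_le[OF d[OF that]] Z sum_exp_pos by (intro mult_mono) (auto intro: less_imp_le)
    also have "\<dots> = (exp (\<epsilon> / 2 * d) * exp (\<epsilon> / 2 * d)) * (exp (- (\<epsilon> / 2) * q2 j) / ?Z q2)" by simp
    also have "exp (\<epsilon> / 2 * d) * exp (\<epsilon> / 2 * d) = exp (\<epsilon> * d)" by (simp add: mult_exp_exp)
    finally show ?thesis using that by (simp add: pmf_exponential_mechanism)
  qed
  have prob: "measure_pmf.prob (exponential_mechanism \<epsilon> J q) S
      = (\<Sum>j\<in>S \<inter> J. pmf (exponential_mechanism \<epsilon> J q) j)" for q
    using J measure_Int_set_pmf[of "exponential_mechanism \<epsilon> J q" S]
    by (simp add: set_pmf_exponential_mechanism measure_measure_pmf_finite)
  show ?thesis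
    unfolding prob sum_distrib_left by (intro sum_mono pmf_le) auto
qed

end

text \<open>The grid given by \<open>k\<close> and \<open>x\<close> is the same for all graphs, so
  mapping the sampled index to a real number is postprocessing and costs no privacy.\<close>

definition grid_mechanism ::
    "nat \<Rightarrow> real \<Rightarrow> (graph \<Rightarrow> nat \<Rightarrow> real) \<Rightarrow> nat \<Rightarrow> (nat \<Rightarrow> real) \<Rightarrow> graph \<Rightarrow> real measure" where
  "grid_mechanism n \<epsilon> s k x G =
     distr (measure_pmf (exponential_mechanism \<epsilon> {..k} (extended_score n s G))) borel x"

lemma randomized_algorithm_grid_mechanism: "randomized_algorithm n (grid_mechanism n \<epsilon> s k x)"
  unfolding randomized_algorithm_def grid_mechanism_def
  by (auto intro!: prob_space.prob_space_distr prob_space_measure_pmf)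

lemma node_DP_grid_mechanism: "0 \<le> \<epsilon> \<Longrightarrow> node_DP n \<epsilon> (grid_mechanism n \<epsilon> s k x)"
  unfolding node_DP_def grid_mechanism_def
  by (auto simp: measure_distr intro!: exponential_mechanism_private extended_score_lipschitz)

section \<open>Regular graphs\<close>

definition pairs :: "nat \<Rightarrow> nat set set" where
  "pairs n = {e. e \<subseteq> {1..n} \<and> card e = 2}"

definition incident :: "nat \<Rightarrow> nat set \<Rightarrow> nat set set" where
  "incident n W = {e \<in> pairs n. e \<inter> W \<noteq> {}}"

definition edge_density :: "nat \<Rightarrow> graph \<Rightarrow> real" where
  "edge_density n G = real (card G) / real (n choose 2)"

text \<open>Edge counts are compared with the graph's own density, so the set does not depend on
  \<open>m\<close>, which the algorithm does not know. All \<open>W\<close> occur because the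
  density has to be Lipschitz across large node distances too.\<close>

definition regular_graphs :: "nat \<Rightarrow> real \<Rightarrow> graph set" where
  "regular_graphs n D = {G \<in> graphs n. \<forall>W\<subseteq>{1..n}.
     \<bar>real (card (G \<inter> incident n W)) - edge_density n G * real (card (incident n W))\<bar> \<le> real (card W) * D}"

lemma graphs_eq: "graphs n = Pow (pairs n)"
  by (simp add: graphs_def pairs_def)

lemma finite_pairs: "finite (pairs n)"
  unfolding pairs_def by (rule finite_subset[of _ "Pow {1..n}"]) auto

lemma card_pairs: "card (pairs n) = n choose 2"
  unfolding pairs_def by (simp add: n_subsets)

lemma incident_subset: "incident n W \<subseteq> pairs n"
  by (auto simp: incident_def)

lemma incident_empty [simp]: "incident n {} = {}"
  by (auto simp: incident_def)

lemma card_incident_le: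
  assumes "W \<subseteq> {1..n}"
  shows "card (incident n W) \<le> card W * n"
proof -
  have fin: "finite (W \<times> {1..n})" using assms finite_subset by auto
  have "incident n W \<subseteq> (\<lambda>(v, u). {v, u}) ` (W \<times> {1..n})"
  proof
    fix e assume e: "e \<in> incident n W"
    then obtain v where v: "v \<in> e" "v \<in> W" by (auto simp: incident_def)
    from e have "card e = 2" "e \<subseteq> {1..n}" by (auto simp: incident_def pairs_def)
    then obtain a b where "e = {a, b}" "a \<in> {1..n}" "b \<in> {1..n}" by (auto simp: card_2_iff)
    with v have "\<exists>u\<in>{1..n}. e = {v, u}" by auto
    then show "e \<in> (\<lambda>(v, u). {v, u}) ` (W \<times> {1..n})" using v by auto
  qed
  then have "card (incident n W) \<le> card (W \<times> {1..n})"
    using fin by (rule surj_card_le[rotated])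
  then show ?thesis by (simp add: card_cartesian_product)
qed

lemma real_choose_two: "real (n choose 2) = real n * (real n - 1) / 2"
  by (simp add: binomial_gbinomial gbinomial_prod_rev numeral_2_eq_2 algebra_simps)

lemma edge_density_bounds:
  assumes "G \<in> graphs n"
  shows "0 \<le> edge_density n G" "edge_density n G \<le> 1"
proof -
  have "card G \<le> n choose 2"
    using assms card_mono[OF finite_pairs, of G n] by (simp add: graphs_eq card_pairs)
  then show "0 \<le> edge_density n G" "edge_density n G \<le> 1"
    by (auto simp: edge_density_def divide_le_eq)
qed

text \<open>Let \<open>T\<close> be the pairs touching an optimal rewiring set \<open>W\<close>.
  Both graphs agree outside \<open>T\<close>, so \<open>N (p - q)\<close> is the difference of their
  counts in \<open>T\<close>, which by regularity is \<open>(p - q) |T|\<close> up to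
  \<open>2 |W| D\<close>. Hence \<open>(N - |T|) |p - q| \<le> 2 |W| D\<close>, and
  \<open>|T| \<le> 3 N / 4\<close> gives the constant \<open>8\<close>.\<close>

lemma edge_density_lipschitz:
  assumes G: "G \<in> regular_graphs n D" and H: "H \<in> regular_graphs n D"
    and n: "3 \<le> n" and k: "4 * node_dist n G H \<le> n"
  shows "\<bar>edge_density n G - edge_density n H\<bar> \<le> real (node_dist n G H) * (8 * D / real (n choose 2))"
proof -
  let ?N = "real (n choose 2)"
  let ?p = "edge_density n G" and ?q = "edge_density n H"
  have gr: "G \<in> graphs n" "H \<in> graphs n" using G H by (auto simp: regular_graphs_def)
  obtain W where W: "W \<subseteq> {1..n}" "card W = node_dist n G H" "rewiring W G H"
    using node_dist_attained[OF gr] by blast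
  define T where "T = incident n W"
  define M where "M = real (card T)"
  define kD where "kD = real (card W) * D"
  have N: "0 < ?N" using n by simp
  have fin: "finite G" "finite H" using gr finite_subset[OF _ finite_pairs] by (auto simp: graphs_eq)
  have diff: "G - T = H - T"
  proof -
    have "e \<in> G \<longleftrightarrow> e \<in> H" if "e \<in> pairs n" "e \<notin> T" for e
      using W(3) that unfolding rewiring_def T_def incident_def by blast
    then show ?thesis using gr by (auto simp: graphs_eq)
  qed
  have split: "real (card K) = real (card (K \<inter> T)) + real (card (K - T))" if "finite K" for K :: graph
    using card_Int_Diff[OF that, of T] by simp
  have cards: "?N * ?p = real (card G)" "?N * ?q = real (card H)"
    using N by (auto simp: edge_density_def)
  have eq: "?N * ?p - ?N * ?q = real (card (G \<inter> T)) - real (card (H \<inter> T))"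
    unfolding cards using split[OF fin(1)] split[OF fin(2)] diff by simp
  have dev: "\<bar>real (card (G \<inter> T)) - ?p * M\<bar> \<le> kD" "\<bar>real (card (H \<inter> T)) - ?q * M\<bar> \<le> kD"
    using G H W(1) unfolding regular_graphs_def T_def M_def kD_def by auto
  have "(?N - M) * (?p - ?q) = (real (card (G \<inter> T)) - ?p * M) - (real (card (H \<inter> T)) - ?q * M)"
    using eq by (simp add: algebra_simps)
  then have le: "\<bar>(?N - M) * (?p - ?q)\<bar> \<le> 2 * kD" using dev by linarith
  \<comment> \<open>Here \<open>4 M \<le> 4 |W| n \<le> n^2\<close>, and
    \<open>n^2 \<le> 3 n (n - 1) / 2\<close> amounts to \<open>3 \<le> n\<close>.\<close>
  have "4 * M \<le> 3 * ?N"
  proof -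
    have "M \<le> real (card W) * real n"
      using card_incident_le[OF W(1)] unfolding M_def T_def by (metis of_nat_le_iff of_nat_mult)
    moreover have "4 * real (card W) \<le> real n" using k W(2) by linarith
    then have "4 * real (card W) * real n \<le> real n * real n" by (intro mult_right_mono) auto
    moreover have "real n * 3 \<le> real n * real n" using n by (intro mult_left_mono) auto
    ultimately show ?thesis by (simp add: real_choose_two algebra_simps)
  qed
  then have "?N / 4 * \<bar>?p - ?q\<bar> \<le> (?N - M) * \<bar>?p - ?q\<bar>" by (intro mult_right_mono) auto
  also have "\<dots> = \<bar>(?N - M) * (?p - ?q)\<bar>" using \<open>4 * M \<le> 3 * ?N\<close> N by (simp add: abs_mult)
  finally have "?N / 4 * \<bar>?p - ?q\<bar> \<le> 2 * kD" using le by simp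
  then show ?thesis using N unfolding kD_def W(2) by (simp add: field_simps)
qed

text \<open>At most \<open>|W| n\<close> pairs touch \<open>W\<close>, so the assumption on
  \<open>D\<close> makes the Chernoff exponent at most \<open>- b |W|\<close>. The union bound over
  nonempty \<open>W\<close> then sums to \<open>2 ((1 + exp (- b)) ^ n - 1)\<close>.\<close>

lemma irregular_probability:
  assumes m: "m \<le> n choose 2" and l: "0 \<le> l" "l \<le> 1"
    and D: "real m / real (n choose 2) * real n * l\<^sup>2 + b \<le> l * D"
    and b: "real n * exp (- b) \<le> 1"
  shows "measure_pmf.prob (uniform_graph n m) (- regular_graphs n D) \<le> 4 * (real n * exp (- b))"
proof -
  let ?N = "n choose 2"
  let ?F = "{G. G \<subseteq> pairs n \<and> card G = m}"
  let ?\<mu> = "\<lambda>W. real m / real ?N * real (card (incident n W))"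
  let ?B = "\<lambda>W. {G. G \<subseteq> pairs n \<and> card G = m \<and>
      real (card W) * D < \<bar>real (card (G \<inter> incident n W)) - ?\<mu> W\<bar>}"
  have F: "{G \<in> graphs n. card G = m} = ?F" by (auto simp: graphs_eq)
  have finF: "finite ?F" using finite_pairs by auto
  have cardF: "card ?F = ?N choose m" using n_subsets[OF finite_pairs] by (simp add: card_pairs)
  have posF: "0 < card ?F" using m by (simp add: cardF)
  have bound: "real (card (?B W)) \<le> 2 * real (card ?F) * exp (- b) ^ card W" if W: "W \<subseteq> {1..n}" for W
  proof -
    have "real (card (?B W)) \<le> 2 * real (?N choose m) * exp (?\<mu> W * l\<^sup>2 - l * (real (card W) * D))"
      using hypergeometric_tail[OF finite_pairs _ _ l, where T = "incident n W" and m = m and a = "real (card W) * D"] m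
      by (simp add: card_pairs incident_subset)
    also have "\<dots> \<le> 2 * real (?N choose m) * exp (real (card W) * (- b))"
    proof -
      have "real (card (incident n W)) \<le> real (card W) * real n"
        using card_incident_le[OF W] by (metis of_nat_le_iff of_nat_mult)
      then have "?\<mu> W * l\<^sup>2 \<le> real m / real ?N * (real (card W) * real n) * l\<^sup>2"
        by (intro mult_right_mono mult_left_mono) auto
      also have "\<dots> = real (card W) * (real m / real ?N * real n * l\<^sup>2)" by simp
      also have "\<dots> \<le> real (card W) * (l * D - b)"
        using D by (intro mult_left_mono) auto
      finally have "?\<mu> W * l\<^sup>2 - l * (real (card W) * D) \<le> real (card W) * (- b)"
        by (simp add: algebra_simps)
      then show ?thesis by (intro mult_left_mono) auto
    qed
    finally show ?thesis by (simp only: exp_of_nat_mult cardF)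
  qed
  \<comment> \<open>The empty set never violates regularity. Leaving it out matters, as its term in
    the sum would be of constant order.\<close>
  have "?F \<inter> - regular_graphs n D \<subseteq> (\<Union>W\<in>Pow {1..n} - {{}}. ?B W)"
  proof
    fix G assume G: "G \<in> ?F \<inter> - regular_graphs n D"
    then obtain W where W: "W \<subseteq> {1..n}"
      "\<not> \<bar>real (card (G \<inter> incident n W)) - edge_density n G * real (card (incident n W))\<bar> \<le> real (card W) * D"
      by (auto simp: regular_graphs_def graphs_eq)
    then have "W \<noteq> {}" by auto
    \<comment> \<open>A graph in \<open>?F\<close> has density \<open>m / N\<close>, so the
      predicted count is the hypergeometric mean.\<close>
    moreover have "G \<in> ?B W" using G W(2) by (auto simp: edge_density_def)
    ultimately show "G \<in> (\<Union>W\<in>Pow {1..n} - {{}}. ?B W)" using W(1) by blast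
  qed
  moreover have "finite (?B W)" for W by (rule finite_subset[OF _ finF]) auto
  ultimately have "card (?F \<inter> - regular_graphs n D) \<le> card (\<Union>W\<in>Pow {1..n} - {{}}. ?B W)"
    by (intro card_mono) auto
  also have "\<dots> \<le> (\<Sum>W\<in>Pow {1..n} - {{}}. card (?B W))" by (rule card_UN_le) auto
  finally have "real (card (?F \<inter> - regular_graphs n D)) \<le> (\<Sum>W\<in>Pow {1..n} - {{}}. real (card (?B W)))"
    by (simp only: of_nat_sum[symmetric] of_nat_le_iff)
  also have "\<dots> \<le> (\<Sum>W\<in>Pow {1..n} - {{}}. 2 * real (card ?F) * exp (- b) ^ card W)"
    by (intro sum_mono bound) auto
  also have "\<dots> = 2 * real (card ?F) * ((1 + exp (- b)) ^ n - 1)"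
  proof -
    have "(\<Sum>W\<in>Pow {1..n} - {{}}. exp (- b) ^ card W) = (\<Sum>W\<in>Pow {1..n}. exp (- b) ^ card W) - 1"
      by (subst sum_diff) auto
    then show ?thesis by (simp add: sum_distrib_left[symmetric] sum_power_card_Pow)
  qed
  \<comment> \<open>With \<open>y = n exp (- b) \<le> 1\<close>, the difference is at most
    \<open>exp y - 1 \<le> y + y^2 \<le> 2 y\<close>.\<close>
  also have "\<dots> \<le> 2 * real (card ?F) * (2 * (real n * exp (- b)))"
  proof (intro mult_left_mono)
    let ?y = "real n * exp (- b)"
    have "(1 + exp (- b)) ^ n \<le> exp (exp (- b)) ^ n" by (intro power_mono) auto
    also have "\<dots> = exp ?y" by (simp add: exp_of_nat_mult)
    also have "\<dots> \<le> 1 + ?y + ?y\<^sup>2" using b by (intro exp_bound) auto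
    also have "?y\<^sup>2 \<le> ?y" using b by (simp add: power2_eq_square mult_left_le)
    finally show "(1 + exp (- b)) ^ n - 1 \<le> 2 * ?y" by simp
  qed simp
  finally have *: "real (card (?F \<inter> - regular_graphs n D)) \<le> 4 * (real n * exp (- b)) * real (card ?F)"
    by (simp add: mult_ac)
  have "?F \<noteq> {}" using posF by (metis card.empty less_irrefl)
  then have "measure_pmf.prob (uniform_graph n m) (- regular_graphs n D)
      = real (card (?F \<inter> - regular_graphs n D)) / real (card ?F)"
    unfolding uniform_graph_def F by (intro measure_pmf_of_set finF)
  also have "\<dots> \<le> 4 * (real n * exp (- b))"
    using * posF by (simp only: divide_le_eq) simp
  finally show ?thesis .
qed

text \<open>The value \<open>n\<close> at the irregular graphs is large enough that they never determine the extended
  score below the level \<open>n / 4\<close>.\<close>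

definition density_score :: "nat \<Rightarrow> real \<Rightarrow> real \<Rightarrow> (nat \<Rightarrow> real) \<Rightarrow> graph \<Rightarrow> nat \<Rightarrow> real" where
  "density_score n D \<delta> x G j =
     (if G \<in> regular_graphs n D then \<bar>x j - edge_density n G\<bar> / \<delta> else real n)"

lemma extended_density_score_upper:
  assumes "G \<in> regular_graphs n D"
  shows "extended_score n (density_score n D \<delta> x) G j \<le> \<bar>x j - edge_density n G\<bar> / \<delta>"
  using extended_score_le[of G n "density_score n D \<delta> x" G j] assms
  by (auto simp: density_score_def regular_graphs_def)

text \<open>Consider a minimiser \<open>H\<close>. If it is regular and within distance
  \<open>n / 4\<close>, the Lipschitz bound for the density gives the first term of the minimum;
  otherwise the distance or the penalty \<open>n\<close> alone contributes at least
  \<open>n / 4\<close>.\<close>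

lemma extended_density_score_lower:
  assumes G: "G \<in> regular_graphs n D" and n: "3 \<le> n" and D: "0 < D"
    and \<delta>: "\<delta> = 8 * D / real (n choose 2)"
  shows "min (\<bar>x j - edge_density n G\<bar> / \<delta>) (real n / 4) \<le> extended_score n (density_score n D \<delta> x) G j"
proof -
  obtain H where H: "H \<in> graphs n" "extended_score n (density_score n D \<delta> x) G j
      = real (node_dist n G H) + density_score n D \<delta> x H j"
    by (rule extended_score_attained)
  have \<delta>0: "0 < \<delta>" using n D by (simp add: \<delta>)
  have score: "0 \<le> density_score n D \<delta> x H j" using \<delta>0 by (simp add: density_score_def)
  show ?thesis
  proof (cases "H \<in> regular_graphs n D \<and> 4 * node_dist n G H \<le> n")
    case True
    then have "\<bar>edge_density n G - edge_density n H\<bar> \<le> real (node_dist n G H) * \<delta>"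
      unfolding \<delta> using edge_density_lipschitz[OF G _ n] by auto
    then have "\<bar>x j - edge_density n G\<bar> \<le> real (node_dist n G H) * \<delta> + \<bar>x j - edge_density n H\<bar>"
      by linarith
    then have "\<bar>x j - edge_density n G\<bar> / \<delta> \<le> real (node_dist n G H) + \<bar>x j - edge_density n H\<bar> / \<delta>"
      using \<delta>0 by (simp add: field_simps)
    then show ?thesis using True H(2) by (simp add: density_score_def)
  next
    case False
    then consider "H \<notin> regular_graphs n D" | "n \<le> 4 * node_dist n G H" by linarith
    then have "real n / 4 \<le> real (node_dist n G H) + density_score n D \<delta> x H j"
      by cases (use score in \<open>simp_all add: density_score_def\<close>)
    then show ?thesis using H(2) by simp
  qed
qed

section \<open>Error of the mechanism\<close>

lemma sum_geometric_inj_le: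
  fixes r :: real
  assumes "finite A" "inj_on h A" "0 \<le> r" "r < 1"
  shows "(\<Sum>j\<in>A. r ^ h j) \<le> 1 / (1 - r)"
proof -
  have "(\<Sum>j\<in>A. r ^ h j) = (\<Sum>i\<in>h ` A. r ^ i)" using assms(2) by (simp add: sum.reindex)
  also have "\<dots> \<le> (\<Sum>i. r ^ i)" using assms by (intro sum_le_suminf) (auto simp: summable_geometric)
  also have "\<dots> = 1 / (1 - r)" using assms by (intro suminf_geometric) auto
  finally show ?thesis .
qed

text \<open>On either side of \<open>c\<close> the distances to the integers grow by one per step,
  so two geometric series bound the sum uniformly in \<open>k\<close> and \<open>c\<close>.\<close>

lemma sum_exp_dist_le:
  fixes c :: real
  assumes "0 \<le> c"
  shows "(\<Sum>j\<le>k. exp (- \<bar>real j - c\<bar> / 4)) \<le> 2 / (1 - exp (- 1 / 4))"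
proof -
  define a where "a = nat \<lfloor>c\<rfloor>"
  define r :: real where "r = exp (- 1 / 4)"
  have r: "0 \<le> r" "r < 1" by (auto simp: r_def)
  have a: "real a \<le> c" "c < real a + 1" using assms by (auto simp: a_def)
  have pow: "exp (- real i / 4) = r ^ i" for i
    by (simp add: r_def exp_of_nat_mult[symmetric])
  have "(\<Sum>j\<le>k. exp (- \<bar>real j - c\<bar> / 4))
      = (\<Sum>j\<in>{..k} \<inter> {..a}. exp (- \<bar>real j - c\<bar> / 4)) + (\<Sum>j\<in>{..k} - {..a}. exp (- \<bar>real j - c\<bar> / 4))"
    by (rule sum.Int_Diff) simp
  \<comment> \<open>As \<open>a \<le> c < a + 1\<close>, points \<open>j \<le> a\<close> are at
    distance at least \<open>a - j\<close> from \<open>c\<close>, and points \<open>j > a\<close> at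
    distance at least \<open>j - (a + 1)\<close>.\<close>
  also have "\<dots> \<le> (\<Sum>j\<in>{..k} \<inter> {..a}. r ^ (a - j)) + (\<Sum>j\<in>{..k} - {..a}. r ^ (j - Suc a))"
  proof (intro add_mono sum_mono)
    fix j assume "j \<in> {..k} \<inter> {..a}"
    then have "exp (- \<bar>real j - c\<bar> / 4) \<le> exp (- real (a - j) / 4)"
      using a by (simp add: of_nat_diff)
    then show "exp (- \<bar>real j - c\<bar> / 4) \<le> r ^ (a - j)" by (simp only: pow)
  next
    fix j assume "j \<in> {..k} - {..a}"
    then have "Suc a \<le> j" by auto
    then have "exp (- \<bar>real j - c\<bar> / 4) \<le> exp (- real (j - Suc a) / 4)"
      using a by (simp add: of_nat_diff)
    then show "exp (- \<bar>real j - c\<bar> / 4) \<le> r ^ (j - Suc a)" by (simp only: pow)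
  qed
  also have "\<dots> \<le> 1 / (1 - r) + 1 / (1 - r)"
    by (intro add_mono sum_geometric_inj_le r) (auto simp: inj_on_def)
  finally show ?thesis by (simp add: r_def)
qed

text \<open>Half of the exponent absorbs the square; \<open>32\<close> comes from the Taylor term
  \<open>(u / 4)^2 / 2 = u^2 / 32\<close>.\<close>

lemma square_exp_le:
  fixes u :: real
  assumes "0 \<le> u"
  shows "u\<^sup>2 * exp (- u / 2) \<le> 32 * exp (- u / 4)"
proof -
  have "1 + u / 4 + (u / 4)\<^sup>2 / 2 \<le> exp (u / 4)"
    using assms by (intro exp_lower_Taylor_quadratic) simp
  then have "u\<^sup>2 \<le> 32 * exp (u / 4)" using assms by (simp add: power2_eq_square)
  then have "u\<^sup>2 * exp (- u / 2) \<le> 32 * exp (u / 4) * exp (- u / 2)" by (intro mult_right_mono) auto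
  also have "\<dots> = 32 * exp (- u / 4)" by (simp add: mult_exp_exp)
  finally show ?thesis .
qed

text \<open>The score is reliable up to the level \<open>B\<close>. Below it the weights decay as
  for discrete Laplace noise of scale \<open>g\<close>, which gives the \<open>g\<^sup>2\<close>
  term. Each of the at most \<open>1 / g + 1\<close> remaining grid points has squared error at most
  \<open>1\<close> and weight at most \<open>exp (- (\<epsilon> / 2) * B)\<close>.\<close>

lemma exponential_mechanism_second_moment:
  fixes \<epsilon> \<delta> p B :: real and q :: "nat \<Rightarrow> real"
  assumes "0 < \<epsilon>" "0 < \<delta>" "0 \<le> p" "p \<le> 1"
  defines "g \<equiv> \<delta> / \<epsilon>"
  assumes lower: "\<And>j. min (\<bar>real j * g - p\<bar> / \<delta>) B \<le> q j"
    and upper: "\<And>j. q j \<le> \<bar>real j * g - p\<bar> / \<delta>"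
  shows "(\<Sum>j\<le>nat \<lfloor>1 / g\<rfloor>. \<bar>real j * g - p\<bar>\<^sup>2 * pmf (exponential_mechanism \<epsilon> {..nat \<lfloor>1 / g\<rfloor>} q) j)
    \<le> exp (1 / 2) * (64 / (1 - exp (- 1 / 4)) * g\<^sup>2 + (1 / g + 1) * exp (- (\<epsilon> / 2) * B))"
proof -
  have g: "0 < g" using assms(1,2) by (simp add: g_def)
  define c where "c = p / g"
  define k where "k = nat \<lfloor>1 / g\<rfloor>"
  define Z where "Z = (\<Sum>i\<le>k. exp (- (\<epsilon> / 2) * q i))"
  have c: "0 \<le> c" "c \<le> 1 / g" using g assms by (auto simp: c_def divide_right_mono)
  have dist: "\<bar>real j * g - p\<bar> = g * \<bar>real j - c\<bar>" for j
  proof -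
    have "real j * g - p = g * (real j - c)" using g by (simp add: c_def field_simps)
    then show ?thesis using g by (simp add: abs_mult)
  qed
  \<comment> \<open>Since \<open>g = \<delta> / \<epsilon>\<close>, the scaled score is the distance
    in grid steps.\<close>
  have scale: "\<epsilon> * (\<bar>real j * g - p\<bar> / \<delta>) = \<bar>real j - c\<bar>" for j
    unfolding dist using assms(1,2) by (simp add: g_def)
  have k: "real k \<le> 1 / g" using g by (simp add: k_def)
  \<comment> \<open>The last grid point not above \<open>p\<close> is within one step of it, so its
    weight is at least \<open>exp (- 1 / 2)\<close>; \<open>p \<le> 1\<close> keeps it inside the
    grid.\<close>
  define i where "i = nat \<lfloor>c\<rfloor>"
  have i: "i \<le> k" unfolding i_def k_def using c by (intro nat_mono floor_mono)
  have "\<bar>real i - c\<bar> \<le> 1" using c(1) unfolding i_def by linarith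
  then have "\<epsilon> * q i \<le> 1"
    using mult_left_mono[OF upper[of i], of \<epsilon>] assms(1) scale[of i] by linarith
  then have "exp (- 1 / 2) \<le> exp (- (\<epsilon> / 2) * q i)" by simp
  also have "\<dots> \<le> Z" unfolding Z_def using i by (intro member_le_sum) auto
  finally have Z: "exp (- 1 / 2) \<le> Z" .
  then have Z0: "0 < Z" by (rule less_le_trans[rotated]) simp
  have "1 / Z \<le> 1 / exp (- 1 / 2 :: real)" using Z by (intro divide_left_mono) (use Z0 in auto)
  then have Zinv: "1 / Z \<le> exp (1 / 2)" by (simp add: exp_minus field_simps)
  have term_le: "\<bar>real j * g - p\<bar>\<^sup>2 * exp (- (\<epsilon> / 2) * q j)
      \<le> 32 * g\<^sup>2 * exp (- \<bar>real j - c\<bar> / 4) + exp (- (\<epsilon> / 2) * B)" if "j \<le> k" for j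
  proof -
    have "real j * g \<le> 1"
    proof -
      have "real j \<le> 1 / g" using that k by linarith
      then show ?thesis using g by (simp add: field_simps)
    qed
    moreover have "0 \<le> real j * g" using g by simp
    ultimately have "\<bar>real j * g - p\<bar> \<le> 1" using assms(3,4) by linarith
    then have sq: "\<bar>real j * g - p\<bar>\<^sup>2 \<le> 1" by (intro power_le_one) auto
    show ?thesis
    proof (cases "B \<le> q j")
      case True
      then have "exp (- (\<epsilon> / 2) * q j) \<le> exp (- (\<epsilon> / 2) * B)" using assms(1) by simp
      then have "\<bar>real j * g - p\<bar>\<^sup>2 * exp (- (\<epsilon> / 2) * q j) \<le> 1 * exp (- (\<epsilon> / 2) * B)"
        using sq by (intro mult_mono) auto
      moreover have "0 \<le> 32 * g\<^sup>2 * exp (- \<bar>real j - c\<bar> / 4)" by simp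
      ultimately show ?thesis by linarith
    next
      case False
      then have "\<bar>real j * g - p\<bar> / \<delta> \<le> q j" using lower[of j] by (auto simp: min_def split: if_splits)
      then have "\<epsilon> * (\<bar>real j * g - p\<bar> / \<delta>) \<le> \<epsilon> * q j" using assms(1) by (intro mult_left_mono) auto
      then have "exp (- (\<epsilon> / 2) * q j) \<le> exp (- \<bar>real j - c\<bar> / 2)" using scale[of j] by simp
      then have "\<bar>real j * g - p\<bar>\<^sup>2 * exp (- (\<epsilon> / 2) * q j) \<le> \<bar>real j * g - p\<bar>\<^sup>2 * exp (- \<bar>real j - c\<bar> / 2)"
        by (intro mult_left_mono) auto
      also have "\<dots> = g\<^sup>2 * (\<bar>real j - c\<bar>\<^sup>2 * exp (- \<bar>real j - c\<bar> / 2))"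
        unfolding dist by (simp add: power_mult_distrib)
      also have "\<dots> \<le> g\<^sup>2 * (32 * exp (- \<bar>real j - c\<bar> / 4))"
        by (intro mult_left_mono square_exp_le) auto
      also have "\<dots> \<le> 32 * g\<^sup>2 * exp (- \<bar>real j - c\<bar> / 4) + exp (- (\<epsilon> / 2) * B)" by simp
      finally show ?thesis .
    qed
  qed
  have "(\<Sum>j\<le>k. \<bar>real j * g - p\<bar>\<^sup>2 * pmf (exponential_mechanism \<epsilon> {..k} q) j)
      = (\<Sum>j\<le>k. \<bar>real j * g - p\<bar>\<^sup>2 * exp (- (\<epsilon> / 2) * q j)) * (1 / Z)"
    by (simp add: pmf_exponential_mechanism Z_def sum_divide_distrib)
  also have "\<dots> \<le> (\<Sum>j\<le>k. 32 * g\<^sup>2 * exp (- \<bar>real j - c\<bar> / 4) + exp (- (\<epsilon> / 2) * B)) * exp (1 / 2)"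
    using term_le Zinv Z0 by (intro mult_mono sum_mono sum_nonneg) (auto intro!: add_nonneg_nonneg)
  also have "\<dots> \<le> (64 / (1 - exp (- 1 / 4)) * g\<^sup>2 + (1 / g + 1) * exp (- (\<epsilon> / 2) * B)) * exp (1 / 2)"
  proof (rule mult_right_mono)
    have "(\<Sum>j\<le>k. 32 * g\<^sup>2 * exp (- \<bar>real j - c\<bar> / 4) + exp (- (\<epsilon> / 2) * B))
        = 32 * g\<^sup>2 * (\<Sum>j\<le>k. exp (- \<bar>real j - c\<bar> / 4)) + (real k + 1) * exp (- (\<epsilon> / 2) * B)"
      by (simp add: sum.distrib sum_distrib_left algebra_simps)
    also have "\<dots> \<le> 32 * g\<^sup>2 * (2 / (1 - exp (- 1 / 4))) + (1 / g + 1) * exp (- (\<epsilon> / 2) * B)"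
      using k c(1) by (intro add_mono mult_left_mono mult_right_mono sum_exp_dist_le) auto
    finally show "(\<Sum>j\<le>k. 32 * g\<^sup>2 * exp (- \<bar>real j - c\<bar> / 4) + exp (- (\<epsilon> / 2) * B))
        \<le> 64 / (1 - exp (- 1 / 4)) * g\<^sup>2 + (1 / g + 1) * exp (- (\<epsilon> / 2) * B)" by simp
  qed simp
  finally show ?thesis by (simp add: k_def mult.commute)
qed

text \<open>The grid spacing equals the noise scale \<open>\<delta> / \<epsilon>\<close>, so the grid point nearest to the density already
  bounds the normalising constant from below.\<close>

definition density_mechanism :: "nat \<Rightarrow> real \<Rightarrow> real \<Rightarrow> graph \<Rightarrow> real measure" where
  "density_mechanism n \<epsilon> D =
    (let \<delta> = 8 * D / real (n choose 2); g = \<delta> / \<epsilon>; x = (\<lambda>j. real j * g)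
     in grid_mechanism n \<epsilon> (density_score n D \<delta> x) (nat \<lfloor>1 / g\<rfloor>) x)"

lemma grid_mechanism_second_moment:
  "(\<integral>\<^sup>+ y. ennreal (\<bar>y - p\<bar>\<^sup>2) \<partial>(grid_mechanism n \<epsilon> s k x G))
    = ennreal (\<Sum>j\<le>k. \<bar>x j - p\<bar>\<^sup>2 * pmf (exponential_mechanism \<epsilon> {..k} (extended_score n s G)) j)"
proof -
  let ?M = "exponential_mechanism \<epsilon> {..k} (extended_score n s G)"
  have set: "set_pmf ?M = {..k}" by (intro set_pmf_exponential_mechanism) auto
  have "(\<integral>\<^sup>+ y. ennreal (\<bar>y - p\<bar>\<^sup>2) \<partial>(grid_mechanism n \<epsilon> s k x G)) = (\<integral>\<^sup>+ j. ennreal (\<bar>x j - p\<bar>\<^sup>2) \<partial>measure_pmf ?M)"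
    unfolding grid_mechanism_def by (subst nn_integral_distr) auto
  also have "\<dots> = (\<Sum>j\<le>k. ennreal (\<bar>x j - p\<bar>\<^sup>2) * ennreal (pmf ?M j))"
    by (subst nn_integral_measure_pmf_finite) (auto simp: set)
  also have "\<dots> = ennreal (\<Sum>j\<le>k. \<bar>x j - p\<bar>\<^sup>2 * pmf ?M j)"
    by (subst sum_ennreal[symmetric]) (auto simp: ennreal_mult)
  finally show ?thesis .
qed

lemma density_mechanism_error_regular:
  fixes n :: nat and \<epsilon> D :: real
  assumes G: "G \<in> regular_graphs n D" and n: "3 \<le> n" and D: "0 < D" and \<epsilon>: "0 < \<epsilon>"
  defines "g \<equiv> 8 * D / real (n choose 2) / \<epsilon>"
  shows "(\<integral>\<^sup>+ y. ennreal (\<bar>y - edge_density n G\<bar>\<^sup>2) \<partial>(density_mechanism n \<epsilon> D G))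
    \<le> ennreal (exp (1 / 2) * (64 / (1 - exp (- 1 / 4)) * g\<^sup>2 + (1 / g + 1) * exp (- (\<epsilon> / 2) * (real n / 4))))"
proof -
  define \<delta> where "\<delta> = 8 * D / real (n choose 2)"
  have \<delta>: "0 < \<delta>" using n D by (simp add: \<delta>_def)
  have dens: "0 \<le> edge_density n G" "edge_density n G \<le> 1"
    using G edge_density_bounds by (auto simp: regular_graphs_def)
  show ?thesis
    unfolding density_mechanism_def Let_def grid_mechanism_second_moment g_def \<delta>_def[symmetric]
    by (intro ennreal_leI exponential_mechanism_second_moment \<epsilon> \<delta> dens
        extended_density_score_upper extended_density_score_lower G n D \<delta>_def)
qed

text \<open>The grid lies in \<open>[0, 1]\<close>, since \<open>j \<le> 1 / g\<close>. This crude
  bound is what irregular graphs are charged.\<close>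

lemma density_mechanism_error_le_1:
  fixes n :: nat and \<epsilon> D :: real
  assumes n: "3 \<le> n" and D: "0 < D" and \<epsilon>: "0 < \<epsilon>" and p: "0 \<le> p" "p \<le> 1"
  shows "(\<integral>\<^sup>+ y. ennreal (\<bar>y - p\<bar>\<^sup>2) \<partial>(density_mechanism n \<epsilon> D G)) \<le> 1"
proof -
  define g where "g = 8 * D / real (n choose 2) / \<epsilon>"
  have g: "0 < g" using n D \<epsilon> by (simp add: g_def)
  define k where "k = nat \<lfloor>1 / g\<rfloor>"
  define M where "M = exponential_mechanism \<epsilon> {..k} (extended_score n (density_score n D (8 * D / real (n choose 2)) (\<lambda>j. real j * g)) G)"
  have "(\<Sum>j\<le>k. \<bar>real j * g - p\<bar>\<^sup>2 * pmf M j) \<le> (\<Sum>j\<le>k. 1 * pmf M j)"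
  proof (intro sum_mono mult_right_mono)
    fix j assume "j \<in> {..k}"
    then have "real j \<le> 1 / g" using g unfolding k_def by (simp add: le_nat_iff le_floor_iff)
    then have "real j * g \<le> 1" "0 \<le> real j * g" using g by (auto simp: field_simps)
    then have "\<bar>real j * g - p\<bar> \<le> 1" using p by linarith
    then show "\<bar>real j * g - p\<bar>\<^sup>2 \<le> 1" by (intro power_le_one) auto
  qed auto
  also have "\<dots> = 1"
    unfolding M_def mult_1 by (intro sum_pmf_eq_1) (auto simp: set_pmf_exponential_mechanism)
  finally show ?thesis
    unfolding density_mechanism_def Let_def grid_mechanism_second_moment g_def[symmetric] k_def[symmetric] M_def[symmetric]
    by (simp add: ennreal_le_1)
qed

lemma mean_square_error_density_mechanism:
  fixes n m :: nat and \<epsilon> D :: real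
  assumes n: "3 \<le> n" and D: "0 < D" and \<epsilon>: "0 < \<epsilon>" and m: "m \<le> n choose 2"
    and prob: "measure_pmf.prob (uniform_graph n m) (- regular_graphs n D) \<le> b"
  defines "g \<equiv> 8 * D / real (n choose 2) / \<epsilon>"
  shows "mean_square_error n m (density_mechanism n \<epsilon> D)
    \<le> ennreal (exp (1 / 2) * (64 / (1 - exp (- 1 / 4)) * g\<^sup>2 + (1 / g + 1) * exp (- (\<epsilon> / 2) * (real n / 4))) + b)"
    (is "_ \<le> ennreal (?E + b)")
proof -
  have g: "0 < g" using n D \<epsilon> by (simp add: g_def)
  have E: "0 \<le> ?E" using g by (intro mult_nonneg_nonneg add_nonneg_nonneg divide_nonneg_nonneg) auto
  let ?F = "{G \<in> graphs n. card G = m}"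
  have "?F = {G. G \<subseteq> pairs n \<and> card G = m}" by (auto simp: graphs_eq)
  then have "card ?F = (n choose 2) choose m" using n_subsets[OF finite_pairs] by (simp add: card_pairs)
  \<comment> \<open>Only for a nonempty set does \<open>pmf_of_set\<close> have the expected
    support; this is where \<open>m \<le> n choose 2\<close> enters.\<close>
  then have "?F \<noteq> {}" using m by (metis binomial_eq_0_iff card.empty not_less)
  then have set: "set_pmf (uniform_graph n m) = ?F"
    unfolding uniform_graph_def by (intro set_pmf_of_set) (auto simp: finite_graphs)
  have "mean_square_error n m (density_mechanism n \<epsilon> D)
      \<le> (\<integral>\<^sup>+ G. ennreal ?E + indicator (- regular_graphs n D) G \<partial>measure_pmf (uniform_graph n m))"
    unfolding mean_square_error_def
  proof (intro nn_integral_mono_AE, unfold AE_measure_pmf_iff set, intro ballI)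
    fix G assume "G \<in> ?F"
    then have p: "real m / real (n choose 2) = edge_density n G" and G: "G \<in> graphs n"
      by (auto simp: edge_density_def)
    show "(\<integral>\<^sup>+ x. ennreal (\<bar>x - real m / real (n choose 2)\<bar>\<^sup>2) \<partial>density_mechanism n \<epsilon> D G)
        \<le> ennreal ?E + indicator (- regular_graphs n D) G"
    proof (cases "G \<in> regular_graphs n D")
      case True
      then show ?thesis
        unfolding p using density_mechanism_error_regular[OF True n D \<epsilon>] by (simp add: g_def)
    next
      case False
      then show ?thesis
        unfolding p using density_mechanism_error_le_1[OF n D \<epsilon> edge_density_bounds[OF G]]
        by (simp add: add_increasing)
    qed
  qed
  also have "\<dots> = ennreal ?E + ennreal (measure_pmf.prob (uniform_graph n m) (- regular_graphs n D))"
    by (subst nn_integral_add) (auto simp: measure_pmf.emeasure_eq_measure)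
  also have "\<dots> \<le> ennreal ?E + ennreal b" by (intro add_left_mono ennreal_leI prob)
  also have "\<dots> = ennreal (?E + b)"
    using E measure_nonneg[of "uniform_graph n m" "- regular_graphs n D"] prob
    by (intro ennreal_plus[symmetric]) linarith+
  finally show ?thesis .
qed

theorem proposition4p2:
  fixes \<epsilon> \<rho> :: "nat \<Rightarrow> real"
  assumes "\<And>n. 0 < \<epsilon> n \<and> \<epsilon> n < 1"
    and "\<And>n. 0 < \<rho> n \<and> \<rho> n < 1"
    and "filterlim (\<lambda>n. \<epsilon> n * real n / ln (real n)) at_top sequentially"
  shows "\<exists>A :: nat \<Rightarrow> graph \<Rightarrow> real measure.
    (\<forall>n. randomized_algorithm n (A n) \<and> node_DP n (\<epsilon> n) (A n)) \<and>
    (\<exists>C::real. \<forall>\<^sub>F n in sequentially. \<forall>m::nat. real m < \<rho> n * real (n choose 2) \<longrightarrow>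
       mean_square_error n m (A n)
         \<le> ennreal (C * (max (\<rho> n) (ln (real n) / real n)
                        * (ln (real n) / (real n ^ 3 * (\<epsilon> n)\<^sup>2)))))"
proof -
  \<comment> \<open>For positive \<open>n\<close>, \<open>R n\<close> is \<open>n\<close> times the
    maximum in the claimed rate. The \<open>6\<close> in \<open>D\<close> splits as
    \<open>1 + 5\<close>: one \<open>ln n\<close> pays for the quadratic term of the Chernoff
    exponent, and five give \<open>exp (- b) = n^(-5)\<close>.\<close>
  define R where "R n = max (\<rho> n * real n) (ln (real n))" for n
  define D where "D n = 6 * sqrt (R n * ln (real n))" for n
  define A where "A n = density_mechanism n (\<epsilon> n) (D n)" for n
  define C0 :: real where "C0 = exp (1 / 2) * (64 / (1 - exp (- 1 / 4)) + 2) + 4"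
  \<comment> \<open>\<open>36864 = 16 * (8 * 6)^2\<close>, with \<open>8\<close> from the Lipschitz
    constant, \<open>6\<close> from \<open>D\<close> and \<open>16\<close> from
    \<open>n choose 2 \<ge> n^2 / 4\<close>.\<close>
  define C where "C = C0 * 36864"
  have C0: "0 \<le> C0" by (auto simp: C0_def intro!: add_nonneg_nonneg mult_nonneg_nonneg divide_nonneg_nonneg)
  \<comment> \<open>This covers every \<open>n\<close>: where \<open>n choose 2\<close> is
    \<open>0\<close>, divisions by zero return \<open>0\<close>, and the grid mechanism is private
    for any score and grid.\<close>
  have dp: "randomized_algorithm n (A n) \<and> node_DP n (\<epsilon> n) (A n)" for n
    using assms(1)[of n] unfolding A_def density_mechanism_def Let_def
    by (auto intro!: randomized_algorithm_grid_mechanism node_DP_grid_mechanism)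
  \<comment> \<open>\<open>48 = 8 * 6\<close> makes the tail \<open>exp (- \<epsilon> n / 8)\<close>
    at most \<open>n^(-6)\<close>.\<close>
  have "\<forall>\<^sub>F n in sequentially. 48 \<le> \<epsilon> n * real n / ln (real n)"
    using assms(3) unfolding filterlim_at_top by blast
  moreover have "\<forall>\<^sub>F n in sequentially. 3 \<le> n" by (rule eventually_ge_at_top)
  ultimately have "\<forall>\<^sub>F n in sequentially. \<forall>m::nat. real m < \<rho> n * real (n choose 2) \<longrightarrow>
       mean_square_error n m (A n)
         \<le> ennreal (C * (max (\<rho> n) (ln (real n) / real n) * (ln (real n) / (real n ^ 3 * (\<epsilon> n)\<^sup>2))))"
  proof (eventually_elim, intro allI impI)
    fix n m :: nat
    assume elim: "48 \<le> \<epsilon> n * real n / ln (real n)" "3 \<le> n" "real m < \<rho> n * real (n choose 2)"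
    let ?e = "\<epsilon> n" and ?L = "ln (real n)" and ?N = "real (n choose 2)"
    let ?rate = "max (\<rho> n) (?L / real n) * (?L / (real n ^ 3 * ?e\<^sup>2))"
    define g where "g = 8 * D n / ?N / ?e"
    have n: "3 \<le> real n" using elim by simp
    have e: "0 < ?e" "?e < 1" and \<rho>: "0 < \<rho> n" "\<rho> n < 1" using assms(1,2) by auto
    have L: "1 \<le> ?L"
    proof -
      have "exp 1 \<le> real n" using exp_le n by linarith
      then show ?thesis using n by (simp add: ln_ge_iff)
    qed
    have expL: "exp (- (real i * ?L)) = 1 / real n ^ i" for i
      using n by (simp add: exp_minus exp_of_nat_mult divide_inverse)
    have R: "?L \<le> R n" "\<rho> n * real n \<le> R n" "0 < R n" using L by (auto simp: R_def)
    have N: "real n ^ 2 / 4 \<le> ?N" "?N \<le> real n ^ 2 / 2"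
    proof -
      have *: "y / 4 \<le> (y - x) / 2 \<and> (y - x) / 2 \<le> y / 2" if "x * 2 \<le> y" "0 \<le> x" for x y :: real
        using that by auto
      have "real n * 2 \<le> real n * real n" using n by (intro mult_left_mono) auto
      from *[OF this] have "real n ^ 2 / 4 \<le> ?N \<and> ?N \<le> real n ^ 2 / 2"
        unfolding real_choose_two power2_eq_square right_diff_distrib mult_1_right by simp
      then show "real n ^ 2 / 4 \<le> ?N" "?N \<le> real n ^ 2 / 2" by blast+
    qed
    have N0: "0 < ?N" using N(1) n by (smt (verit) divide_pos_pos zero_less_power)
    have sqrtRL: "?L \<le> sqrt (R n * ?L)"
      using R L by (intro real_le_rsqrt) (simp add: power2_eq_square)
    have D: "6 \<le> D n" unfolding D_def using sqrtRL L by linarith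
    have rate: "?rate = R n * ?L / (real n ^ 4 * ?e\<^sup>2)"
    proof -
      have "max (\<rho> n) (?L / real n) = R n / real n"
        using n by (simp add: R_def max_def field_simps)
      then show ?thesis using n by (simp add: power3_eq_cube power4_eq_xxxx)
    qed
    have g2: "g\<^sup>2 \<le> 36864 * ?rate"
    proof -
      have "g\<^sup>2 = 2304 * (R n * ?L) / (?N\<^sup>2 * ?e\<^sup>2)"
        using R L by (simp add: g_def D_def power_divide power_mult_distrib)
      also have "\<dots> \<le> 2304 * (R n * ?L) / ((real n ^ 2 / 4)\<^sup>2 * ?e\<^sup>2)"
        using R L N e n by (intro divide_left_mono mult_right_mono power_mono mult_pos_pos) auto
      also have "\<dots> = 36864 * ?rate"
        unfolding rate by (simp add: power_divide)
      finally show ?thesis .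
    qed
    \<comment> \<open>A lower bound on the noise scale. It lets \<open>g\<^sup>2\<close> absorb all
      terms of order \<open>n^(-4)\<close> and bounds the number of grid points.\<close>
    have g1: "1 / real n ^ 2 \<le> g"
    proof -
      have "1 / real n ^ 2 \<le> 48 / (real n ^ 2 / 2)" using n by (simp add: field_simps)
      also have "\<dots> \<le> 8 * D n / ?N" using D N N0 by (intro frac_le) auto
      also have "\<dots> \<le> g" using e D N0 unfolding g_def by (simp add: le_divide_eq mult_left_le)
      finally show ?thesis .
    qed
    then have g0: "0 < g" using n by (smt (verit) divide_pos_pos zero_less_power)
    have small: "1 / real n ^ 4 \<le> g\<^sup>2"
    proof -
      have "(1 / real n ^ 2)\<^sup>2 \<le> g\<^sup>2" using g1 by (intro power_mono) auto
      then show ?thesis by (simp add: power_divide)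
    qed
    have m: "real m / ?N \<le> \<rho> n" using elim(3) N0 by (simp add: divide_le_eq)
    then have "real m / ?N \<le> 1" using \<rho> by linarith
    then have mN: "m \<le> n choose 2" using N0 by (simp add: divide_le_eq)
    \<comment> \<open>With \<open>b = 5 ln n\<close> the union bound leaves \<open>4 n^(-4)\<close>.
      The form \<open>real 5\<close> lets \<open>expL\<close> rewrite the exponential.\<close>
    have prob: "measure_pmf.prob (uniform_graph n m) (- regular_graphs n (D n)) \<le> 4 * (real n * exp (- (real 5 * ?L)))"
    proof (rule irregular_probability[OF mN])
      \<comment> \<open>This choice makes the quadratic term at most \<open>ln n\<close> and
        \<open>l D = 6 ln n\<close>. It is at most \<open>1\<close> because
        \<open>ln n \<le> R n\<close>, which is why \<open>R\<close> is a maximum.\<close>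
      let ?l = "sqrt (?L / R n)"
      show "0 \<le> ?l" "?l \<le> 1" using R L by auto
      have "real m / ?N * real n * ?l\<^sup>2 \<le> R n * (?L / R n)"
      proof -
        have "real m / ?N * real n \<le> \<rho> n * real n" using m by (intro mult_right_mono) auto
        then have "real m / ?N * real n \<le> R n" using R(2) by linarith
        moreover have "?l\<^sup>2 = ?L / R n" using R L by simp
        moreover have "0 \<le> ?L / R n" using R L by simp
        ultimately show ?thesis by (simp only: mult_right_mono)
      qed
      also have "\<dots> = ?L" using R by simp
      finally have "real m / ?N * real n * ?l\<^sup>2 \<le> ?L" .
      moreover have "?l * D n = 6 * ?L"
      proof -
        have "?l * sqrt (R n * ?L) = sqrt (?L\<^sup>2)"
          unfolding real_sqrt_mult[symmetric] using R by (simp add: power2_eq_square)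
        then show ?thesis using L by (simp add: D_def)
      qed
      ultimately show "real m / ?N * real n * ?l\<^sup>2 + real 5 * ?L \<le> ?l * D n" by simp
      show "real n * exp (- (real 5 * ?L)) \<le> 1"
        unfolding expL using n self_le_power[of "real n" 5] by simp
    qed
    \<comment> \<open>The factor \<open>1 / g + 1\<close> is at most \<open>2 n^2\<close> and the
      exponential at most \<open>n^(-6)\<close>, so the product is at most
      \<open>2 n^(-4)\<close>.\<close>
    have tail: "(1 / g + 1) * exp (- (?e / 2) * (real n / 4)) \<le> 2 * g\<^sup>2"
    proof -
      have "48 * ?L \<le> ?e * real n" using elim(1) L by (simp add: field_simps)
      then have "exp (- (?e / 2) * (real n / 4)) \<le> exp (- (real 6 * ?L))" by simp
      moreover have "1 / g \<le> real n ^ 2" using g1 g0 n by (simp add: field_simps)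
      moreover have "1 \<le> real n ^ 2" using n by (intro one_le_power) auto
      ultimately have "(1 / g + 1) * exp (- (?e / 2) * (real n / 4)) \<le> (2 * real n ^ 2) * (1 / real n ^ 6)"
        unfolding expL by (intro mult_mono) auto
      also have "\<dots> = 2 * (1 / real n ^ 4)" using n by (simp add: field_simps power_add[symmetric])
      finally show ?thesis using small by linarith
    qed
    have "mean_square_error n m (A n)
      \<le> ennreal (exp (1 / 2) * (64 / (1 - exp (- 1 / 4)) * g\<^sup>2
          + (1 / g + 1) * exp (- (?e / 2) * (real n / 4))) + 4 * (real n * exp (- (real 5 * ?L))))"
      unfolding A_def g_def
      using elim(2) D e(1) mN prob by (intro mean_square_error_density_mechanism) auto
    also have "\<dots> \<le> ennreal (C * ?rate)"
    proof (rule ennreal_leI)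
      have "4 * (real n * exp (- (real 5 * ?L))) = 4 * (1 / real n ^ 4)"
        unfolding expL using n by (simp add: power4_eq_xxxx power_numeral_reduce)
      moreover have "exp (1 / 2) * (64 / (1 - exp (- 1 / 4)) * g\<^sup>2 + (1 / g + 1) * exp (- (?e / 2) * (real n / 4)))
          \<le> exp (1 / 2) * (64 / (1 - exp (- 1 / 4)) * g\<^sup>2 + 2 * g\<^sup>2)"
        using tail by (intro mult_left_mono add_left_mono) auto
      ultimately have "exp (1 / 2) * (64 / (1 - exp (- 1 / 4)) * g\<^sup>2 + (1 / g + 1) * exp (- (?e / 2) * (real n / 4)))
          + 4 * (real n * exp (- (real 5 * ?L))) \<le> exp (1 / 2) * (64 / (1 - exp (- 1 / 4)) * g\<^sup>2 + 2 * g\<^sup>2) + 4 * g\<^sup>2"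
        using small by linarith
      also have "\<dots> = C0 * g\<^sup>2" by (simp add: C0_def algebra_simps)
      also have "\<dots> \<le> C0 * (36864 * ?rate)" by (intro mult_left_mono g2 C0)
      also have "\<dots> = C * ?rate" by (simp only: C_def mult.assoc)
      finally show "exp (1 / 2) * (64 / (1 - exp (- 1 / 4)) * g\<^sup>2 + (1 / g + 1) * exp (- (?e / 2) * (real n / 4)))
          + 4 * (real n * exp (- (real 5 * ?L))) \<le> C * ?rate" .
    qed
    finally show "mean_square_error n m (A n) \<le> ennreal (C * ?rate)" .
  qed
  then show ?thesis using dp by blast
qed

end
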